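(* The group $\mathbb{Z}_2^3$ cannot be realized by a 3-net in $\mathbb{P}^2$.
   Context: A 3-net in $\mathbb{P}^2$ is a pair $(\mathcal{A},\mathcal{X})$ where $\mathcal{A}$ is a finite set of lines in the complex projective plane partitioned into 3 classes $\mathcal{A}=\mathcal{A}_1\cup\mathcal{A}_2\cup\mathcal{A}_3$ and $\mathcal{X}$ is a finite set of points such that: (i) for every $i\neq j$ and every $l\in\mathcal{A}_i$, $l'\in\mathcal{A}_j$, $l\cap l'\in\mathcal{X}$; (ii) for every $X\in\mathcal{X}$ and every $i$ there is a unique $l\in\mathcal{A}_i$ through $X$. A 3-net realizes a group $H$ if there are bijections $\phi_i:H\to\mathcal{A}_i$ ($i=1,2,3$) such that for all $a,b\in H$ the line $\phi_3(ab)$ passes through the point $\phi_1(a)\cap\phi_2(b)$. *)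

theory Defs
  imports "HOL-Analysis.Analysis" "HOL-Algebra.Elementary_Groups"
begin

text \<open>
  The complex projective plane is the projectivization of \<open>\<complex>\<^sup>3\<close>: its points and lines are the
  complex linear subspaces of dimension 1 and 2 (\<open>vec.subspace\<close> and \<open>vec.dim\<close> refer to the complex
  scalar multiplication \<open>*s\<close>, not to the real one). A point \<open>P\<close> lies on a line \<open>l\<close> iff \<open>P \<subseteq> l\<close>,
  and for distinct lines \<open>l\<close>, \<open>l'\<close> the common point is the subspace \<open>l \<inter> l'\<close>.
\<close>

definition proj_points :: "(complex^3) set set" where
  "proj_points = {P. vec.subspace P \<and> vec.dim P = 1}"

definition proj_lines :: "(complex^3) set set" where
  "proj_lines = {l. vec.subspace l \<and> vec.dim l = 2}"

text \<open>The three classes of the partition of \<open>\<A>\<close> are \<open>C 1\<close>, \<open>C 2\<close>, \<open>C 3\<close>; other values of \<open>C\<close>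
  are irrelevant.\<close>

definition three_net ::
  "(complex^3) set set \<Rightarrow> (nat \<Rightarrow> (complex^3) set set) \<Rightarrow> (complex^3) set set \<Rightarrow> bool" where
  "three_net \<A> C \<X> \<longleftrightarrow>
     finite \<A> \<and> \<A> \<subseteq> proj_lines \<and>
     finite \<X> \<and> \<X> \<subseteq> proj_points \<and>
     \<A> = C 1 \<union> C 2 \<union> C 3 \<and>
     disjoint_family_on C {1,2,3} \<and> (\<forall>i\<in>{1,2,3}. C i \<noteq> {}) \<and>
     (\<forall>i\<in>{1,2,3}. \<forall>j\<in>{1,2,3}. i \<noteq> j \<longrightarrow> (\<forall>l\<in>C i. \<forall>l'\<in>C j. l \<inter> l' \<in> \<X>)) \<and>
     (\<forall>P\<in>\<X>. \<forall>i\<in>{1,2,3}. \<exists>!l. l \<in> C i \<and> P \<subseteq> l)"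

definition net_realizes :: "(nat \<Rightarrow> (complex^3) set set) \<Rightarrow> 'g monoid \<Rightarrow> bool" where
  "net_realizes C H \<longleftrightarrow>
     (\<exists>\<phi> :: nat \<Rightarrow> 'g \<Rightarrow> (complex^3) set.
        (\<forall>i\<in>{1,2,3}. bij_betw (\<phi> i) (carrier H) (C i)) \<and>
        (\<forall>a\<in>carrier H. \<forall>b\<in>carrier H. \<phi> 1 a \<inter> \<phi> 2 b \<subseteq> \<phi> 3 (a \<otimes>\<^bsub>H\<^esub> b)))"

definition realizable_in_P2 :: "'g monoid \<Rightarrow> bool" where
  "realizable_in_P2 H \<longleftrightarrow> (\<exists>\<A> C \<X>. three_net \<A> C \<X> \<and> net_realizes C H)"

end

theory Submission
  imports Defs
begin

text \<open>
  Represent the lines of the three classes by covectors \<open>a\<^sub>g\<close>, \<open>b\<^sub>g\<close>, \<open>c\<^sub>g\<close>. For a group of exponent 2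
  with identity \<open>0\<close> the relations inside the subgroup generated by \<open>g\<close> allow the simultaneous
  rescaling \<open>c\<^sub>0 = a\<^sub>0 + b\<^sub>0\<close>, \<open>c\<^sub>g = a\<^sub>g + b\<^sub>0\<close>, \<open>b\<^sub>g = a\<^sub>0 + b\<^sub>0 + a\<^sub>g\<close>. Put \<open>z\<^sub>g = det (a\<^sub>0, b\<^sub>0, a\<^sub>g)\<close>,
  which is nonzero for \<open>g \<noteq> 0\<close>. For distinct nonzero \<open>g\<close>, \<open>h\<close> the six conditions
  \<open>det (a\<^sub>p, a\<^sub>0 + b\<^sub>0 + a\<^sub>q, b\<^sub>0 + a\<^sub>r) = 0\<close>, with \<open>(p, q, r)\<close> running through the permutations of
  \<open>(g, h, g + h)\<close>, add up to \<open>z\<^sub>g + z\<^sub>h + z\<^bsub>g+h\<^esub> = 0\<close>. Summing this over the lines of the Fano plane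
  of nonzero elements of \<open>\<int>\<^sub>2\<^sup>3\<close> forces all \<open>z\<^sub>g\<close> to vanish.
\<close>

section \<open>Determinants and linear dependence of covectors\<close>

text \<open>Bilinear, with no complex conjugation, so that incidence is polynomial in both
  arguments.\<close>

definition dot3 :: "complex^3 \<Rightarrow> complex^3 \<Rightarrow> complex" where
  "dot3 u v = u$1 * v$1 + u$2 * v$2 + u$3 * v$3"

definition cross3c :: "complex^3 \<Rightarrow> complex^3 \<Rightarrow> complex^3" where
  "cross3c u v =
     vector [u$2 * v$3 - u$3 * v$2, u$3 * v$1 - u$1 * v$3, u$1 * v$2 - u$2 * v$1]"

text \<open>The determinant of the matrix with rows \<open>u\<close>, \<open>v\<close>,
  \<open>w\<close>.\<close>

definition triple :: "complex^3 \<Rightarrow> complex^3 \<Rightarrow> complex^3 \<Rightarrow> complex" where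
  "triple u v w = dot3 (cross3c u v) w"

definition dual_line :: "complex^3 \<Rightarrow> (complex^3) set" where
  "dual_line n = {x. dot3 n x = 0}"

lemma triple_expand:
  "triple u v w = (u$2 * v$3 - u$3 * v$2) * w$1 + (u$3 * v$1 - u$1 * v$3) * w$2
     + (u$1 * v$2 - u$2 * v$1) * w$3"
  by (simp add: triple_def dot3_def cross3c_def vector_3)

lemma triple_smult:
  "triple (t *s u) v w = t * triple u v w"
  "triple u (t *s v) w = t * triple u v w"
  "triple u v (t *s w) = t * triple u v w"
  by (simp_all add: triple_expand algebra_simps)

lemma triple_repeat:
  "triple u u v = 0" "triple u v u = 0" "triple v u u = 0"
  by (simp_all add: triple_expand algebra_simps)

lemma triple_zero:
  "triple 0 v w = 0" "triple u 0 w = 0" "triple u v 0 = 0"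
  by (simp_all add: triple_expand)

text \<open>Cramer's rule. The product form of the coefficients lets incidence and general position
  decide which of them vanish.\<close>

lemma triple_cramer:
  assumes "triple u v w \<noteq> 0"
  obtains p q r where "x = p *s u + q *s v + r *s w"
    "triple x v w = p * triple u v w" "triple u x w = q * triple u v w"
    "triple u v x = r * triple u v w"
proof -
  have "triple u v w *s x = triple x v w *s u + triple u x w *s v + triple u v x *s w"
    by (simp add: vec_eq_iff forall_3 triple_expand algebra_simps)
  then have "(1 / triple u v w) *s (triple u v w *s x) =
      (1 / triple u v w) *s (triple x v w *s u + triple u x w *s v + triple u v x *s w)"
    by simp
  then have "x = (triple x v w / triple u v w) *s u + (triple u x w / triple u v w) *s v
      + (triple u v x / triple u v w) *s w"
    using assms by (simp add: vector_add_ldistrib vector_smult_assoc)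
  then show thesis
    using that assms by simp
qed

lemma cross3c_eq_0D:
  assumes "cross3c u v = 0" "u \<noteq> 0"
  shows "\<exists>t. v = t *s u"
proof -
  have eqs: "u$2 * v$3 = u$3 * v$2" "u$3 * v$1 = u$1 * v$3" "u$1 * v$2 = u$2 * v$1"
    using assms(1) by (simp_all add: cross3c_def vec_eq_iff forall_3 vector_3)
  obtain i where i: "u$i \<noteq> 0"
    using assms(2) by (auto simp: vec_eq_iff)
  have "u$i * v$j = u$j * v$i" for j
    using eqs exhaust_3[of i] exhaust_3[of j] by auto
  then have "v = (v$i / u$i) *s u"
    using i by (simp add: vec_eq_iff field_simps)
  then show ?thesis by blast
qed

section \<open>Projective lines as kernels of covectors\<close>

lemma subspace_dual_line: "vec.subspace (dual_line n)"
  by (auto simp: vec.subspace_def dual_line_def dot3_def algebra_simps)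
    (metis distrib_left mult_zero_right add.assoc)

text \<open>The cross product of a basis of \<open>l\<close> annihilates \<open>l\<close>; a
  dimension count turns this inclusion into equality.\<close>

lemma proj_line_eq_dual_line:
  assumes "l \<in> proj_lines"
  obtains n where "n \<noteq> 0" "l = dual_line n"
proof -
  have l: "vec.subspace l" "vec.dim l = 2"
    using assms by (auto simp: proj_lines_def)
  obtain B where B: "B \<subseteq> l" "vec.independent B" "vec.span B = l" "card B = 2"
    using vec.basis_subspace_exists[OF l(1)] l(2) by metis
  obtain u v where uv: "B = {u, v}" "u \<noteq> v"
    using B(4) by (auto simp: card_2_iff)
  define n where "n = cross3c u v"
  have "vec.independent {v, u}"
    using B(2) uv by (simp add: insert_commute)
  then have ind: "u \<noteq> 0" "v \<notin> vec.span {u}"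
    using uv(2) vec.dependent_zero[of "{v, u}"] by (auto simp: vec.independent_insert)
  have n: "n \<noteq> 0"
    using cross3c_eq_0D[of u v] ind by (auto simp: n_def vec.span_singleton)
  have "u \<in> dual_line n" "v \<in> dual_line n"
    by (simp_all add: n_def dual_line_def dot3_def cross3c_def vector_3 algebra_simps)
  then have sub: "l \<subseteq> dual_line n"
    using B(3) uv vec.span_minimal[OF _ subspace_dual_line, of B n] by simp
  obtain i where i: "n$i \<noteq> 0"
    using n by (auto simp: vec_eq_iff)
  \<comment> \<open>A unit vector outside the kernel makes the kernel proper, hence of dimension at
    most 2.\<close>
  have "axis i 1 \<notin> dual_line n"
    using i exhaust_3[of i] by (auto simp: dual_line_def dot3_def axis_def)
  moreover have "vec.span (dual_line n) = dual_line n"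
    by (simp only: vec.span_eq_iff subspace_dual_line)
  ultimately have "vec.span (dual_line n) \<subset> vec.span UNIV"
    by (metis UNIV_I psubsetI subset_UNIV vec.span_UNIV)
  from vec.dim_psubset[OF this] have "vec.dim (dual_line n) < 3"
    by (simp only: vec_dim_card) simp
  then have "l = dual_line n"
    using vec.subspace_dim_equal[OF l(1) subspace_dual_line sub] l(2) by simp
  with n show thesis using that by blast
qed

text \<open>The common point is spanned by \<open>cross3c a b\<close>, and
  \<open>triple a b c\<close> is the value of the covector \<open>c\<close> there.\<close>

lemma concurrent_iff_triple_eq_0:
  assumes "a \<noteq> 0" "b \<noteq> 0" "dual_line a \<in> proj_lines"
    and "dual_line a \<inter> dual_line b \<in> proj_points"
  shows "dual_line a \<inter> dual_line b \<subseteq> dual_line c \<longleftrightarrow> triple a b c = 0"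
proof -
  let ?P = "dual_line a \<inter> dual_line b" and ?x = "cross3c a b"
  have P: "vec.subspace ?P" "vec.dim ?P = 1" and d2: "vec.dim (dual_line a) = 2"
    using assms by (auto simp: proj_points_def proj_lines_def)
  have "?x \<noteq> 0"
  proof
    \<comment> \<open>Proportional covectors would make the intersection a whole line instead of a
      point.\<close>
    assume "?x = 0"
    then obtain t where t: "b = t *s a"
      using cross3c_eq_0D assms(1) by blast
    have "dot3 b y = t * dot3 a y" for y
      by (simp add: t dot3_def algebra_simps)
    then have "?P = dual_line a"
      by (auto simp: dual_line_def)
    with P(2) d2 show False by simp
  qed
  moreover have xP: "?x \<in> ?P"
    by (simp add: dual_line_def dot3_def cross3c_def vector_3 algebra_simps)
  ultimately have "vec.span {?x} = ?P"
    using vec.subspace_dim_equal[of "vec.span {?x}" ?P] P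
      vec.span_minimal[of "{?x}" ?P] by (simp add: vec.dim_span)
  moreover have "vec.span {?x} \<subseteq> dual_line c \<longleftrightarrow> ?x \<in> dual_line c"
    using vec.span_minimal[OF _ subspace_dual_line, of "{?x}" c] vec.span_base[of ?x "{?x}"]
    by blast
  moreover have "?x \<in> dual_line c \<longleftrightarrow> triple a b c = 0"
    by (simp add: dual_line_def triple_def dot3_def mult.commute)
  ultimately show ?thesis by simp
qed

section \<open>Rescaling and the relation for a Klein four-group\<close>

text \<open>In the basis \<open>e\<close>, \<open>w\<close>, \<open>a\<close> the three incidences
  successively remove the \<open>e\<close>-component of \<open>c\<close>, equate the
  \<open>e\<close>- and \<open>w\<close>-components of \<open>b\<close>, and fix the
  \<open>a\<close>-component of \<open>b\<close>. The conditions \<open>gen\<close> keep the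
  remaining coefficients of \<open>c\<close> nonzero.\<close>

lemma normalize_pair:
  assumes c: "c0 = e + w" and basis: "triple e w a \<noteq> 0" and "b \<noteq> 0"
    and inc: "triple a w c = 0" "triple a b c0 = 0" "triple e b c = 0"
    and gen: "triple e w c \<noteq> 0" "triple e c a \<noteq> 0"
  obtains s q r where "s \<noteq> 0" "q \<noteq> 0" "r \<noteq> 0"
    "c = q *s (s *s a + w)" "b = r *s (e + w + s *s a)"
proof -
  obtain p q r where c_eq: "c = p *s e + q *s w + r *s a"
    and pqr: "triple c w a = p * triple e w a" "triple e c a = q * triple e w a"
    "triple e w c = r * triple e w a"
    using triple_cramer[OF basis] by metis
  have "triple a w c = - triple c w a"
    by (simp add: triple_expand algebra_simps)
  with inc(1) pqr(1) basis have "p = 0" by simp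
  from pqr gen have "q \<noteq> 0" "r \<noteq> 0" by auto
  define s where "s = r / q"
  have c': "c = q *s (s *s a + w)"
    using c_eq \<open>p = 0\<close> \<open>q \<noteq> 0\<close>
    by (simp add: s_def vec_eq_iff field_simps)
  obtain x y t where b_eq: "b = x *s e + y *s w + t *s a"
    using triple_cramer[OF basis] by metis
  have "triple a b c0 = (x - y) * triple e w a"
    by (simp add: b_eq c triple_expand algebra_simps)
  with inc(2) basis have "x = y" by simp
  have "triple e b c = q * (y * s - t) * triple e w a"
    by (simp add: b_eq c' triple_expand algebra_simps)
  with inc(3) basis \<open>q \<noteq> 0\<close> have "t = y * s" by simp
  have b': "b = y *s (e + w + s *s a)"
    by (simp add: b_eq \<open>x = y\<close> \<open>t = y * s\<close> vec_eq_iff algebra_simps)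
  have "s \<noteq> 0" "y \<noteq> 0"
    using \<open>q \<noteq> 0\<close> \<open>r \<noteq> 0\<close> \<open>b \<noteq> 0\<close> b' by (auto simp: s_def)
  with c' b' \<open>q \<noteq> 0\<close> show thesis by (intro that)
qed

text \<open>After multilinear expansion, the terms containing at least two of \<open>a1\<close>,
  \<open>a2\<close>, \<open>a3\<close> cancel by antisymmetry; each \<open>triple e w\<close> term
  survives twice.\<close>

lemma klein_sum_zero:
  assumes "triple a1 (e + w + a2) (a3 + w) = 0" "triple a1 (e + w + a3) (a2 + w) = 0"
    and "triple a2 (e + w + a1) (a3 + w) = 0" "triple a2 (e + w + a3) (a1 + w) = 0"
    and "triple a3 (e + w + a1) (a2 + w) = 0" "triple a3 (e + w + a2) (a1 + w) = 0"
  shows "triple e w a1 + triple e w a2 + triple e w a3 = 0"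
proof -
  have "2 * (triple e w a1 + triple e w a2 + triple e w a3) =
      triple a1 (e + w + a2) (a3 + w) + triple a1 (e + w + a3) (a2 + w)
    + triple a2 (e + w + a1) (a3 + w) + triple a2 (e + w + a3) (a1 + w)
    + triple a3 (e + w + a1) (a2 + w) + triple a3 (e + w + a2) (a1 + w)"
    by (simp add: triple_expand algebra_simps)
  also have "\<dots> = 0"
    by (simp only: assms add_0)
  finally show ?thesis
    by (simp only: mult_eq_0_iff) simp
qed

section \<open>Weights of a net over a group of exponent two\<close>

text \<open>The nonvanishing conditions are instances of the net axiom that the crossing of two
  lines of different classes lies on only one line of each class.\<close>

locale exponent_two_net = comm_group G for G :: "'g monoid" (structure) +
  fixes a b c :: "'g \<Rightarrow> complex^3"
  assumes square: "g \<in> carrier G \<Longrightarrow> g \<otimes> g = \<one>"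
    and incident: "\<lbrakk>g \<in> carrier G; h \<in> carrier G\<rbrakk> \<Longrightarrow> triple (a g) (b h) (c (g \<otimes> h)) = 0"
    and a_b_a: "\<lbrakk>g \<in> carrier G; g' \<in> carrier G; h \<in> carrier G; g \<noteq> g'\<rbrakk>
      \<Longrightarrow> triple (a g) (b h) (a g') \<noteq> 0"
    and a_b_c: "\<lbrakk>g \<in> carrier G; h \<in> carrier G; k \<in> carrier G; k \<noteq> g \<otimes> h\<rbrakk>
      \<Longrightarrow> triple (a g) (b h) (c k) \<noteq> 0"
    and a_c_a: "\<lbrakk>g \<in> carrier G; g' \<in> carrier G; k \<in> carrier G; g \<noteq> g'\<rbrakk>
      \<Longrightarrow> triple (a g) (c k) (a g') \<noteq> 0"
    and b_c_b: "\<lbrakk>h \<in> carrier G; h' \<in> carrier G; k \<in> carrier G; h \<noteq> h'\<rbrakk>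
      \<Longrightarrow> triple (b h) (c k) (b h') \<noteq> 0"
    and nontrivial: "\<exists>g \<in> carrier G. g \<noteq> \<one>"
begin

lemma normalized_origin:
  obtains p q where "p \<noteq> 0" "q \<noteq> 0" "c \<one> = p *s a \<one> + q *s b \<one>"
proof -
  obtain g where g: "g \<in> carrier G" "g \<noteq> \<one>"
    using nontrivial by blast
  have basis: "triple (a \<one>) (b \<one>) (a g) \<noteq> 0"
    using a_b_a g by auto
  obtain p q r where c0: "c \<one> = p *s a \<one> + q *s b \<one> + r *s a g"
    and r: "triple (a \<one>) (b \<one>) (c \<one>) = r * triple (a \<one>) (b \<one>) (a g)"
    using triple_cramer[OF basis] by metis
  \<comment> \<open>The third line lies in the pencil of the first two. A vanishing \<open>p\<close>
    or \<open>q\<close> would make it proportional to one of them, against general position.\<close>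
  have "r = 0"
    using r basis incident[of \<one> \<one>] by simp
  moreover have "p \<noteq> 0"
    using b_c_b[of \<one> g \<one>] g c0 \<open>r = 0\<close> by (auto simp: triple_smult triple_repeat)
  moreover have "q \<noteq> 0"
    using a_c_a[of \<one> g \<one>] g c0 \<open>r = 0\<close> by (auto simp: triple_smult triple_repeat)
  ultimately show thesis
    using that[of p q] c0 by simp
qed

lemma weights_exist:
  obtains z :: "'g \<Rightarrow> complex" where
    "\<And>g. \<lbrakk>g \<in> carrier G; g \<noteq> \<one>\<rbrakk> \<Longrightarrow> z g \<noteq> 0"
    "\<And>g h. \<lbrakk>g \<in> carrier G; h \<in> carrier G; g \<noteq> \<one>; h \<noteq> \<one>; g \<noteq> h\<rbrakk>
       \<Longrightarrow> z g + z h + z (g \<otimes> h) = 0"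
proof -
  obtain p q where pq: "p \<noteq> 0" "q \<noteq> 0" "c \<one> = p *s a \<one> + q *s b \<one>"
    by (rule normalized_origin)
  \<comment> \<open>Absorbing the coefficients gives \<open>c \<one> = e + w\<close>, the form that
    \<open>normalize_pair\<close> expects.\<close>
  define e w where "e = p *s a \<one>" and "w = q *s b \<one>"
  have "\<exists>s t r. s \<noteq> 0 \<and> t \<noteq> 0 \<and> r \<noteq> 0 \<and>
      c g = t *s (s *s a g + w) \<and> b g = r *s (e + w + s *s a g)"
    if g: "g \<in> carrier G" "g \<noteq> \<one>" for g
  proof -
    have "b g \<noteq> 0"
      using a_b_a[of \<one> g g] g by (auto simp: triple_zero)
    moreover have "triple e w (a g) \<noteq> 0"
      using a_b_a[of \<one> g \<one>] g pq by (auto simp: e_def w_def triple_smult)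
    moreover have "triple (a g) w (c g) = 0"
      using incident[of g \<one>] g by (simp add: w_def triple_smult)
    moreover have "triple (a g) (b g) (c \<one>) = 0"
      using incident[of g g] g square by simp
    moreover have "triple e (b g) (c g) = 0"
      using incident[of \<one> g] g by (simp add: e_def triple_smult)
    moreover have "triple e w (c g) \<noteq> 0"
      using a_b_c[of \<one> \<one> g] g pq by (simp add: e_def w_def triple_smult)
    moreover have "triple e (c g) (a g) \<noteq> 0"
      using a_c_a[of \<one> g g] g pq by (auto simp: e_def triple_smult)
    ultimately show ?thesis
      using normalize_pair[of "c \<one>" e w "a g" "b g" "c g"] pq(3)
      unfolding e_def[symmetric] w_def[symmetric] by metis
  qed
  \<comment> \<open>Only \<open>s\<close> enters the weights; \<open>t\<close> and \<open>r\<close>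
    merely multiply determinants that vanish, so they can stay existential.\<close>
  then obtain s where s: "\<And>g. \<lbrakk>g \<in> carrier G; g \<noteq> \<one>\<rbrakk> \<Longrightarrow> s g \<noteq> 0 \<and>
      (\<exists>t r. t \<noteq> 0 \<and> r \<noteq> 0 \<and>
        c g = t *s (s g *s a g + w) \<and> b g = r *s (e + w + s g *s a g))"
    by metis
  define a' where "a' g = s g *s a g" for g
  define z where "z g = triple e w (a' g)" for g
  have nz: "z g \<noteq> 0" if g: "g \<in> carrier G" "g \<noteq> \<one>" for g
    using a_b_a[of \<one> g \<one>] g pq s[OF g, THEN conjunct1]
    by (simp add: z_def a'_def e_def w_def triple_smult)
  have inc: "triple (a' g) (e + w + a' h) (a' k + w) = 0"
    if ghk: "g \<in> carrier G" "h \<in> carrier G" "k \<in> carrier G" "g \<noteq> \<one>" "h \<noteq> \<one>" "k \<noteq> \<one>"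
      "g \<otimes> h = k"
    for g h k
  proof -
    obtain t where t: "t \<noteq> 0" "c k = t *s (a' k + w)"
      using s[OF ghk(3,6)] unfolding a'_def by blast
    obtain r where r: "r \<noteq> 0" "b h = r *s (e + w + a' h)"
      using s[OF ghk(2,5)] unfolding a'_def by blast
    have "triple (a g) (b h) (c k) = 0"
      using incident[OF ghk(1,2)] ghk(7) by simp
    then have "triple (a g) (e + w + a' h) (a' k + w) = 0"
      unfolding t(2) r(2) triple_smult using t(1) r(1) by simp
    then show ?thesis
      by (simp add: a'_def[of g] triple_smult)
  qed
  have "z g + z h + z (g \<otimes> h) = 0"
    if g: "g \<in> carrier G" "h \<in> carrier G" "g \<noteq> \<one>" "h \<noteq> \<one>" "g \<noteq> h" for g h
  proof -
    \<comment> \<open>Together with the identity, \<open>g\<close>, \<open>h\<close>,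
      \<open>?k\<close> form a Klein four-group: any two of them multiply to the third, which
      supplies all six incidences.\<close>
    let ?k = "g \<otimes> h"
    have k: "?k \<in> carrier G" using g by simp
    have gk: "g \<otimes> ?k = h"
      using g by (simp add: m_assoc[symmetric] square)
    have hk: "h \<otimes> ?k = g"
      using g gk by (metis m_assoc m_comm r_one square)
    have "?k \<noteq> \<one>"
      using g gk by auto
    have comm: "h \<otimes> g = ?k" "?k \<otimes> g = h" "?k \<otimes> h = g"
      using g k gk hk by (simp_all add: m_comm)
    show ?thesis
      unfolding z_def
      by (rule klein_sum_zero; rule inc) (use g k \<open>?k \<noteq> \<one>\<close> gk hk comm in auto)
  qed
  with nz show thesis by (rule that)
qed

end

text \<open>Adding up the three lines through a point \<open>x\<close> gives \<open>2 * x + S = 0\<close> with \<open>S\<close> the total weight,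
  so all weights agree.\<close>

lemma fano_weights_zero:
  fixes x1 x2 x3 x12 x13 x23 x123 :: complex
  assumes "x1 + x2 + x12 = 0" "x1 + x3 + x13 = 0" "x2 + x3 + x23 = 0"
    and "x12 + x3 + x123 = 0" "x13 + x2 + x123 = 0" "x1 + x23 + x123 = 0"
    and "x12 + x13 + x23 = 0"
  shows "x1 = 0"
proof -
  define S where "S = x1 + x2 + x3 + x12 + x13 + x23 + x123"
  have "2 * x1 + S = (x1 + x2 + x12) + (x1 + x3 + x13) + (x1 + x23 + x123)"
    and "2 * x2 + S = (x1 + x2 + x12) + (x2 + x3 + x23) + (x13 + x2 + x123)"
    and "2 * x12 + S = (x1 + x2 + x12) + (x12 + x3 + x123) + (x12 + x13 + x23)"
    by (simp_all add: S_def)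
  then have "2 * x1 + S = 0" "2 * x2 + S = 0" "2 * x12 + S = 0"
    using assms by simp_all
  then have "x1 = x2" "x1 = x12"
    by (metis add_right_cancel mult_cancel_left zero_neq_numeral)+
  with assms(1) show ?thesis by simp
qed

section \<open>From a realization to covectors\<close>

text \<open>The class \<open>k\<close> may equal \<open>i\<close> or \<open>j\<close>; this case
  yields general position within one class.\<close>

lemma three_net_triples:
  assumes net: "three_net \<A> C \<X>"
    and ij: "i \<in> {1,2,3}" "j \<in> {1,2,3}" "k \<in> {1,2,3}" "i \<noteq> j"
    and l: "dual_line u \<in> C i" "dual_line v \<in> C j" and nz: "u \<noteq> 0" "v \<noteq> 0"
  shows "dual_line u \<inter> dual_line v \<subseteq> dual_line x \<longleftrightarrow> triple u v x = 0"
    and "\<exists>!l. l \<in> C k \<and> dual_line u \<inter> dual_line v \<subseteq> l"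
proof -
  have lines: "C i \<subseteq> proj_lines" and points: "\<X> \<subseteq> proj_points"
    using net ij(1) by (auto simp: three_net_def)
  have "\<forall>i\<in>{1,2,3}. \<forall>j\<in>{1,2,3}. i \<noteq> j \<longrightarrow> (\<forall>l\<in>C i. \<forall>l'\<in>C j. l \<inter> l' \<in> \<X>)"
    using net unfolding three_net_def by (elim conjE)
  then have X: "dual_line u \<inter> dual_line v \<in> \<X>"
    using ij l by blast
  have unique: "\<forall>P\<in>\<X>. \<forall>i\<in>{1,2,3}. \<exists>!l. l \<in> C i \<and> P \<subseteq> l"
    using net unfolding three_net_def by (elim conjE)
  show "dual_line u \<inter> dual_line v \<subseteq> dual_line x \<longleftrightarrow> triple u v x = 0"
    using concurrent_iff_triple_eq_0 nz lines points l(1) X by blast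
  show "\<exists>!l. l \<in> C k \<and> dual_line u \<inter> dual_line v \<subseteq> l"
    using unique[THEN bspec, OF X, THEN bspec, OF ij(3)] .
qed

lemma exponent_two_net_if_realizable:
  fixes G :: "'g monoid" (structure)
  assumes "comm_group G" and sq: "\<And>g. g \<in> carrier G \<Longrightarrow> g \<otimes> g = \<one>"
    and nontriv: "\<exists>g \<in> carrier G. g \<noteq> \<one>" and "realizable_in_P2 G"
  obtains a b c where "exponent_two_net G a b c"
proof -
  interpret comm_group G by fact
  obtain \<A> C \<X> \<phi> where net: "three_net \<A> C \<X>"
    and bij: "\<And>i. i \<in> {1,2,3} \<Longrightarrow> bij_betw (\<phi> i) (carrier G) (C i)"
    and real: "\<And>g h. \<lbrakk>g \<in> carrier G; h \<in> carrier G\<rbrakk> \<Longrightarrow> \<phi> 1 g \<inter> \<phi> 2 h \<subseteq> \<phi> 3 (g \<otimes> h)"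
    using assms(4) unfolding realizable_in_P2_def net_realizes_def by metis
  have mem: "\<phi> i g \<in> C i" if "i \<in> {1,2,3}" "g \<in> carrier G" for i g
    using bij that by (meson bij_betwE)
  have inj: "g = h" if "\<phi> i g = \<phi> i h" "i \<in> {1,2,3}" "g \<in> carrier G" "h \<in> carrier G" for i g h
    using bij[of i] that by (auto simp: bij_betw_def inj_on_def)
  have "\<exists>n. n \<noteq> 0 \<and> \<phi> i g = dual_line n" if "i \<in> {1,2,3}" "g \<in> carrier G" for i g
  proof -
    have "\<phi> i g \<in> proj_lines"
      using net mem[OF that] that(1) by (auto simp: three_net_def)
    then show ?thesis
      using proj_line_eq_dual_line by metis
  qed
  then obtain n where n: "n i g \<noteq> 0" "\<phi> i g = dual_line (n i g)"
    if "i \<in> {1,2,3}" "g \<in> carrier G" for i g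
    by metis
  have memn: "dual_line (n i g) \<in> C i" if "i \<in> {1,2,3}" "g \<in> carrier G" for i g
    using mem n that by metis
  have iff: "\<phi> i g \<inter> \<phi> j h \<subseteq> \<phi> k x \<longleftrightarrow> triple (n i g) (n j h) (n k x) = 0"
    if "i \<in> {1,2,3}" "j \<in> {1,2,3}" "k \<in> {1,2,3}" "i \<noteq> j"
      "g \<in> carrier G" "h \<in> carrier G" "x \<in> carrier G" for i j k g h x
    using three_net_triples(1)[OF net that(1-4) memn memn] n that by simp
  \<comment> \<open>Two vanishing determinants put two lines of class \<open>k\<close> through one
    crossing. The four nonvanishing axioms are contrapositives of this.\<close>
  have unique: "x = y"
    if "triple (n i g) (n j h) (n k x) = 0" "triple (n i g) (n j h) (n k y) = 0"
      "i \<in> {1,2,3}" "j \<in> {1,2,3}" "k \<in> {1,2,3}" "i \<noteq> j"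
      "g \<in> carrier G" "h \<in> carrier G" "x \<in> carrier G" "y \<in> carrier G" for i j k g h x y
  proof -
    have "\<exists>!l. l \<in> C k \<and> \<phi> i g \<inter> \<phi> j h \<subseteq> l"
      using three_net_triples(2)[OF net that(3-6) memn memn] n that by simp
    then have "\<phi> k x = \<phi> k y"
      using iff mem that by metis
    then show ?thesis using inj that by blast
  qed
  have "exponent_two_net G (n 1) (n 2) (n 3)"
  proof (unfold_locales, goal_cases)
    case (1 g)
    then show ?case by (rule sq)
  next
    case (2 g h)
    then show ?case using real iff[of 1 2 3 g h "g \<otimes> h"] by simp
  next
    case (3 g g' h)
    \<comment> \<open>The comparison line is \<open>g\<close> itself: its determinant vanishes
      because a covector is repeated.\<close>
    then show ?case using unique[of 1 g 2 h 1 g g'] by (auto simp: triple_repeat)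
  next
    case (4 g h k)
    then show ?case
      \<comment> \<open>Here the comparison line is the one that the realization puts through the
        crossing.\<close>
      using unique[of 1 g 2 h 3 "g \<otimes> h" k] real iff[of 1 2 3 g h "g \<otimes> h"] by auto
  next
    case (5 g g' k)
    then show ?case using unique[of 1 g 3 k 1 g g'] by (auto simp: triple_repeat)
  next
    case (6 h h' k)
    then show ?case using unique[of 2 h 3 k 2 h h'] by (auto simp: triple_repeat)
  next
    case 7
    then show ?case by (rule nontriv)
  qed
  then show thesis by (rule that)
qed

theorem theorem4p2:
  shows "\<not> realizable_in_P2
           (integer_mod_group 2 \<times>\<times> (integer_mod_group 2 \<times>\<times> integer_mod_group 2))"
proof
  let ?G = "integer_mod_group 2 \<times>\<times> (integer_mod_group 2 \<times>\<times> integer_mod_group 2)"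
  assume real: "realizable_in_P2 ?G"
  have "group ?G"
    by (intro DirProd_group group_integer_mod_group)
  then have comm: "comm_group ?G"
    by (rule group.group_comm_groupI) (auto simp: add.commute)
  have sq: "g \<otimes>\<^bsub>?G\<^esub> g = \<one>\<^bsub>?G\<^esub>" for g
    by (cases g) simp
  have carrier: "carrier ?G = {0..<2} \<times> {0..<2} \<times> {0..<2}"
    by (simp add: carrier_integer_mod_group)
  have "(1, 0, 0) \<in> carrier ?G" "(1, 0, 0) \<noteq> \<one>\<^bsub>?G\<^esub>"
    by (simp_all add: carrier)
  then obtain a b c where "exponent_two_net ?G a b c"
    using exponent_two_net_if_realizable[OF comm sq _ real] by blast
  then obtain z :: "int \<times> int \<times> int \<Rightarrow> complex"
    where nz: "\<And>g. \<lbrakk>g \<in> carrier ?G; g \<noteq> \<one>\<^bsub>?G\<^esub>\<rbrakk> \<Longrightarrow> z g \<noteq> 0"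
    and sum: "\<And>g h. \<lbrakk>g \<in> carrier ?G; h \<in> carrier ?G; g \<noteq> \<one>\<^bsub>?G\<^esub>; h \<noteq> \<one>\<^bsub>?G\<^esub>; g \<noteq> h\<rbrakk>
       \<Longrightarrow> z g + z h + z (g \<otimes>\<^bsub>?G\<^esub> h) = 0"
    by (rule exponent_two_net.weights_exist) (rule that)
  have "z (1, 0, 0) = 0"
    \<comment> \<open>The digits in a variable name list the nonzero coordinates. The arguments
      follow the order of occurrence in the assumptions, so \<open>x12\<close> comes before
      \<open>x3\<close>.\<close>
    by (rule fano_weights_zero[of "z (1, 0, 0)" "z (0, 1, 0)" "z (1, 1, 0)" "z (0, 0, 1)"
          "z (1, 0, 1)" "z (0, 1, 1)" "z (1, 1, 1)"])
      (use sum[of "(1, 0, 0)" "(0, 1, 0)"] sum[of "(1, 0, 0)" "(0, 0, 1)"]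
        sum[of "(0, 1, 0)" "(0, 0, 1)"] sum[of "(1, 1, 0)" "(0, 0, 1)"]
        sum[of "(1, 0, 1)" "(0, 1, 0)"] sum[of "(1, 0, 0)" "(0, 1, 1)"]
        sum[of "(1, 1, 0)" "(1, 0, 1)"] in \<open>simp_all add: carrier\<close>)
  then show False
    using nz[of "(1, 0, 0)"] by (simp add: carrier)
qed

end
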